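(* Let $\delta>0$, let $\mu:\bar\Omega\to(0,\infty)$ be a given weight function, and for $v\in C(\bar\Omega)$ define $$L_{\delta,\mu}v(x)=\frac{1}{\delta^2}\int_\Omega R_\delta(x,y)(v(x)-v(y))\,dy+\frac{2v(x)}{\mu(x)}\int_{\partial\Omega}\bar R_\delta(x,y)\,dS_y,\qquad x\in\bar\Omega.$$ If $u\in C(\bar\Omega)$ and $L_{\delta,\mu}u\ge 0$ on $\bar\Omega$, then $u\ge 0$ on $\bar\Omega$.
   Context: $\Omega\subset\mathbb{R}^n$ is a bounded connected open set with smooth ($C^\infty$) boundary; $dS_y$ is surface measure on $\partial\Omega$. The function $R:[0,\infty)\to[0,\infty)$ satisfies: $R\in C^1([0,1])$; $R(r)\ge 0$ and $R(r)=0$ for all $r>1$; there is $\gamma_0>0$ with $R(r)\ge\gamma_0$ for $0\le r\le \frac12$. Set $\bar R(r)=\int_r^{\infty}R(s)\,ds$. For $\delta>0$ put $$R_\delta(x,y)=\alpha_n\delta^{-n}R\left(\frac{|x-y|^2}{4\delta^2}\right),\qquad \bar R_\delta(x,y)=\alpha_n\delta^{-n}\bar R\left(\frac{|x-y|^2}{4\delta^2}\right),$$ where the constant $\alpha_n>0$ is chosen so that $\int_{\mathbb{R}^n}\bar R_\delta(x,y)\,dy=1$. *)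

theory Defs
  imports "HOL-Analysis.Analysis"
begin

section \<open>Smooth bounded domains\<close>

text \<open>\<open>f\<close> is \<open>C\<^sup>k\<close> on the whole space. Requiring all iterated partial derivatives to be
  (Frechet) differentiable makes the quantification over all \<open>k\<close> the usual \<open>C\<^sup>\<infinity>\<close>.\<close>

primrec C_k :: "nat \<Rightarrow> ('a::euclidean_space \<Rightarrow> real) \<Rightarrow> bool" where
  "C_k 0 f \<longleftrightarrow> continuous_on UNIV f"
| "C_k (Suc k) f \<longleftrightarrow> (\<forall>x. f differentiable (at x)) \<and>
     (\<forall>b\<in>Basis. C_k k (\<lambda>x. frechet_derivative f (at x) b))"

definition C_infinity :: "('a::euclidean_space \<Rightarrow> real) \<Rightarrow> bool" where
  "C_infinity f \<longleftrightarrow> (\<forall>k. C_k k f)"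

text \<open>Near each of its boundary points, \<open>\<Omega>\<close> is the part of a ball lying strictly on one side of the
  graph of a \<open>C\<^sup>\<infinity>\<close> function of \<open>n - 1\<close> of the coordinates, up to the choice of the remaining
  coordinate \<open>i\<close> and of its orientation \<open>s\<close>. A function of the coordinates other than \<open>i\<close> is
  represented by a function on the whole space that is invariant under translations along the
  \<open>i\<close>-th axis. For \<open>n = 1\<close> such functions are constants.\<close>

definition smooth_boundary :: "(real^'n) set \<Rightarrow> bool" where
  "smooth_boundary \<Omega> \<longleftrightarrow>
    (\<forall>p\<in>frontier \<Omega>. \<exists>r>0. \<exists>i. \<exists>s\<in>{-1, 1}. \<exists>g :: real^'n \<Rightarrow> real.
       C_infinity g \<and> (\<forall>x t. g (x + t *\<^sub>R axis i 1) = g x) \<and>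
       \<Omega> \<inter> ball p r = {x \<in> ball p r. s * x $ i > g x})"

section \<open>Surface measure\<close>

text \<open>The \<open>k\<close>-dimensional Hausdorff measure, normalised by the volume of the unit ball so that it is
  Lebesgue measure on \<open>k\<close>-dimensional Euclidean space and, for \<open>k = n - 1\<close>, surface measure
  on smooth hypersurfaces of \<open>n\<close>-dimensional space. Empty covering sets must not contribute, which
  matters only for \<open>k = 0\<close> (counting measure), where \<open>0 ^ 0 = 1\<close>. Boundedness of the covering sets
  is required because \<open>diameter\<close> is meaningless on unbounded sets.\<close>

definition hausdorff_pre :: "nat \<Rightarrow> real \<Rightarrow> 'a::metric_space set \<Rightarrow> ennreal" where
  "hausdorff_pre k e A =
    (INF C\<in>{C :: nat \<Rightarrow> 'a set. A \<subseteq> (\<Union>j. C j) \<and> (\<forall>j. bounded (C j) \<and> diameter (C j) \<le> e)}.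
       \<Sum>j. if C j = {} then 0 else ennreal (unit_ball_vol (real k) * (diameter (C j) / 2) ^ k))"

definition hausdorff_outer :: "nat \<Rightarrow> 'a::metric_space set \<Rightarrow> ennreal" where
  "hausdorff_outer k A = (SUP e\<in>{0<..}. hausdorff_pre k e A)"

text \<open>\<open>hausdorff_outer k\<close> is a metric outer measure, hence countably additive on the Borel sets, so
  that \<open>measure_of\<close> does not degenerate here.\<close>

definition hausdorff_measure :: "nat \<Rightarrow> 'a::metric_space measure" where
  "hausdorff_measure k = measure_of UNIV (sets borel) (hausdorff_outer k)"

definition surface_measure :: "(real^'n) measure" where
  "surface_measure = hausdorff_measure (CARD('n) - 1)"

section \<open>Kernels and the operator\<close>

text \<open>Only the values of the profile \<open>R\<close> on \<open>[0,\<infinity>)\<close> matter. At the end points of \<open>[0,1]\<close> the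
  derivative is one-sided; \<open>R\<close> may jump at \<open>1\<close>.\<close>

definition kernel_profile :: "(real \<Rightarrow> real) \<Rightarrow> bool" where
  "kernel_profile R \<longleftrightarrow>
    (\<exists>R'. continuous_on {0..1} R' \<and>
       (\<forall>r\<in>{0..1}. (R has_real_derivative R' r) (at r within {0..1}))) \<and>
    (\<forall>r\<ge>0. R r \<ge> 0) \<and>
    (\<forall>r>1. R r = 0) \<and>
    (\<exists>\<gamma>\<^sub>0>0. \<forall>r\<in>{0..1/2}. R r \<ge> \<gamma>\<^sub>0)"

definition kernel_bar :: "(real \<Rightarrow> real) \<Rightarrow> real \<Rightarrow> real" where
  "kernel_bar R r = (LINT s:{r..}|lborel. R s)"

text \<open>With \<open>R\<close> and \<open>kernel_bar R\<close> as profile this gives the kernels \<open>R\<^sub>\<delta>\<close> and its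
  barred counterpart, respectively.\<close>

definition scaled_kernel :: "real \<Rightarrow> (real \<Rightarrow> real) \<Rightarrow> real \<Rightarrow> real^'n \<Rightarrow> real^'n \<Rightarrow> real" where
  "scaled_kernel \<alpha> R \<delta> x y = \<alpha> / \<delta> ^ CARD('n) * R ((norm (x - y))\<^sup>2 / (4 * \<delta>\<^sup>2))"

definition L_op :: "real \<Rightarrow> (real \<Rightarrow> real) \<Rightarrow> (real^'n) set \<Rightarrow> real \<Rightarrow> (real^'n \<Rightarrow> real) \<Rightarrow>
    (real^'n \<Rightarrow> real) \<Rightarrow> real^'n \<Rightarrow> real" where
  "L_op \<alpha> R \<Omega> \<delta> \<mu> v x =
     1 / \<delta>\<^sup>2 * (LINT y:\<Omega>|lborel. scaled_kernel \<alpha> R \<delta> x y * (v x - v y)) +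
     2 * v x / \<mu> x * (LINT y:frontier \<Omega>|surface_measure. scaled_kernel \<alpha> (kernel_bar R) \<delta> x y)"

end

theory Submission
  imports Defs
begin

text \<open>
  The theorem is a minimum principle. Suppose that the minimum of \<open>u\<close> over the closed domain is negative.
  At a minimum point \<open>x\<close> both terms of \<open>L_op\<close> are nonpositive: the integrand \<open>R\<^sub>\<delta>(x,y) (u x - u y)\<close> is, and
  so is \<open>u x\<close>, which multiplies a nonnegative boundary integral. As their sum is nonnegative, both vanish. The
  kernel is positive at distances less than \<open>\<delta>\<close>, so \<open>u\<close> equals its minimum at all points within
  distance \<open>\<delta>\<close> of \<open>x\<close> (\<open>eq_min_near\<close>). Hence the set of minimum points is open and closed in the closed
  domain, which is connected, and \<open>u\<close> is a negative constant. At a boundary point the diffusion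
  term is then zero, and the boundary term would have to vanish, but it is negative
  (\<open>boundary_integral_pos\<close>).

  Most of the work is in the last claim, that the boundary integral is positive at boundary points. It
  depends on three facts about surface measure. First, the Hausdorff measure is not the zero measure by default of
  \<open>measure_of\<close>: on Borel sets it has the values of the Hausdorff outer measure
  (\<open>emeasure_hausdorff_measure\<close>), which is Caratheodory's theorem for metric outer measures. Second, the
  boundary of a bounded smooth domain has finite measure (\<open>emeasure_frontier_finite\<close>), so that the
  kernel is integrable; locally the boundary is the graph of a Lipschitz function, and a grid gives economical
  covers. Third, the part of the boundary near one of its points has positive measure
  (\<open>emeasure_frontier_ball_pos\<close>), because its projection along an axis contains an open subset of a hyperplane.
\<close>

section \<open>Metric outer measures\<close>

text \<open>
  For a function that is additive on sets at positive distance, closed sets satisfy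
  Caratheodory's splitting condition. Write \<open>X - F\<close> as the increasing union of the parts
  \<open>Y n\<close> at distance more than \<open>1 / (n + 1)\<close> from \<open>F\<close>. Each \<open>Y n\<close> is separated from \<open>F\<close>,
  so it remains to see that the leftovers \<open>(X - F) - Y n\<close> become negligible. They are unions of
  the distance rings \<open>D m\<close> with \<open>m \<ge> n\<close>. Any two rings whose indices differ by at least \<open>2\<close> are
  separated, so the even rings, and likewise the odd ones, have total content at most \<open>f X\<close>;
  hence the contents of all the rings form a convergent series, whose tails vanish.
\<close>

lemma closed_in_lambda_system:
  fixes f :: "'a::metric_space set \<Rightarrow> ennreal"
  assumes outer: "outer_measure_space UNIV f"
    and separated: "\<And>A B d. \<lbrakk>d > 0; \<And>a b. \<lbrakk>a \<in> A; b \<in> B\<rbrakk> \<Longrightarrow> d \<le> dist a b\<rbrakk> \<Longrightarrow> f A + f B \<le> f (A \<union> B)"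
    and F: "closed F"
  shows "F \<in> lambda_system UNIV UNIV f"
proof -
  have mono: "f A \<le> f B" if "A \<subseteq> B" for A B
    using outer that by (auto simp: outer_measure_space_def increasing_def)
  have f0: "f {} = 0"
    using outer by (auto simp: outer_measure_space_def positive_def)
  interpret sigma_algebra UNIV "UNIV :: 'a set set"
    using sigma_algebra_Pow[of "UNIV :: 'a set"] by simp
  have "subadditive UNIV f"
    using outer by (auto simp: outer_measure_space_def intro: countably_subadditive_subadditive)
  have sub2: "f (A \<union> B) \<le> f A + f B" for A B
  proof -
    have "f (A \<union> B) = f (A \<union> (B - A))" by simp
    also have "\<dots> \<le> f A + f (B - A)"
      using subadditiveD[OF \<open>subadditive UNIV f\<close>, of A "B - A"] by simp
    also have "\<dots> \<le> f A + f B" by (intro add_mono mono) auto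
    finally show ?thesis .
  qed
  have subc: "f (\<Union>i. A i) \<le> (\<Sum>i. f (A i))" for A :: "nat \<Rightarrow> 'a set"
  proof -
    have "f (\<Union>i. A i) = f (\<Union>i. disjointed A i)" by (simp add: UN_disjointed_eq)
    also have "\<dots> \<le> (\<Sum>i. f (disjointed A i))"
      using outer disjoint_family_disjointed[of A]
      by (auto simp: outer_measure_space_def countably_subadditive_def)
    also have "\<dots> \<le> (\<Sum>i. f (A i))"
      by (intro suminf_le mono disjointed_subset summableI)
    finally show ?thesis .
  qed
  have le: "f (X \<inter> F) + f (X - F) \<le> f X" if "F \<noteq> {}" "f X < top" for X
  proof (rule ennreal_le_epsilon)
    fix e :: real assume "0 < e"
    define D where "D m = {x \<in> X - F. 1 / real (m + 2) < infdist x F \<and> infdist x F \<le> 1 / real (m + 1)}" for m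
    define Y where "Y m = {x \<in> X - F. 1 / real (m + 1) < infdist x F}" for m
    have gap: "1 / real i - 1 / real (i + 1) \<le> dist x y"
      if "j + 2 \<le> i" "x \<in> D j" "y \<in> D i" for i j x y
    proof -
      have "1 / real i \<le> 1 / real (j + 2)" 
        using that(1) by (intro divide_left_mono mult_pos_pos) (simp_all del: of_nat_add)
      moreover have "infdist x F \<le> infdist y F + dist x y" by (rule infdist_triangle)
      moreover have "1 / real (j + 2) < infdist x F" "infdist y F \<le> 1 / real (i + 1)"
        using that(2,3) unfolding D_def by blast+
      ultimately show ?thesis by linarith
    qed
    \<comment> \<open>neighbouring rings may touch, hence only indices of one parity \<open>p\<close> at a time\<close>
    have alternate: "(\<Sum>k<N. f (D (2 * k + p))) \<le> f (\<Union>k<N. D (2 * k + p))" for N p :: nat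
    proof (induction N)
      case 0 then show ?case by (simp add: f0)
    next
      case (Suc N)
      show ?case
      proof (cases "N = 0")
        case True then show ?thesis by (simp add: lessThan_Suc)
      next
        case False
        let ?i = "2 * N + p"
        have "f (\<Union>k<N. D (2 * k + p)) + f (D ?i) \<le> f ((\<Union>k<N. D (2 * k + p)) \<union> D ?i)"
        proof (rule separated)
          show "0 < 1 / real ?i - 1 / real (?i + 1)" using False by (simp add: divide_simps)
          show "1 / real ?i - 1 / real (?i + 1) \<le> dist a b"
            if "a \<in> (\<Union>k<N. D (2 * k + p))" "b \<in> D ?i" for a b
          proof -
            from that obtain k where "k < N" "a \<in> D (2 * k + p)" by blast
            with that(2) show ?thesis by (intro gap[of "2 * k + p"]) auto
          qed
        qed
        moreover have "(\<Union>k<N. D (2 * k + p)) \<union> D ?i = (\<Union>k<Suc N. D (2 * k + p))"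
          by (auto simp: lessThan_Suc)
        ultimately show ?thesis
          using order_trans[OF add_right_mono[OF Suc.IH, of "f (D ?i)"]] by (simp only: sum.lessThan_Suc)
      qed
    qed
    have pairs: "(\<Sum>m<2 * N. f (D m)) = (\<Sum>k<N. f (D (2 * k + 0))) + (\<Sum>k<N. f (D (2 * k + 1)))" for N
      by (induction N) (auto simp: ac_simps)
    have DX: "(\<Union>k<N. D (2 * k + p)) \<subseteq> X" for N p by (auto simp: D_def)
    have "(\<Sum>m<n. f (D m)) \<le> f X + f X" for n
    proof -
      have "(\<Sum>m<n. f (D m)) \<le> (\<Sum>m<2 * n. f (D m))"
        by (intro sum_mono2) auto
      also have "\<dots> \<le> f X + f X"
        unfolding pairs by (intro add_mono order_trans[OF alternate mono[OF DX]])
      finally show ?thesis .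
    qed
    then have "(\<Sum>m. f (D m)) \<le> f X + f X"
      by (intro suminf_le_const) auto
    also have "\<dots> < top" using that(2) by (simp add: less_top[symmetric])
    finally have fin: "(\<Sum>m. f (D m)) < top" .
    define g where "g m = enn2real (f (D m))" for m
    have "0 \<le> g m" for m by (simp add: g_def)
    have fg: "f (D m) = ennreal (g m)" for m
      using ennreal_suminf_lessD[OF fin, of m] by (simp add: g_def)
    have "summable g"
      using fin unfolding fg
      by (intro summable_suminf_not_top) (auto simp: \<open>\<And>m. 0 \<le> g m\<close>)
    then obtain n where n: "norm (\<Sum>i. g (i + n)) < e"
      using suminf_exist_split[OF \<open>0 < e\<close>] by blast
    have tail: "(\<Sum>i. f (D (i + n))) \<le> ennreal e"
    proof -
      have "(\<Sum>i. f (D (i + n))) = ennreal (\<Sum>i. g (i + n))"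
        unfolding fg using summable_ignore_initial_segment[OF \<open>summable g\<close>]
        by (intro suminf_ennreal2) (auto simp: \<open>\<And>m. 0 \<le> g m\<close>)
      then show ?thesis using n by (auto intro!: ennreal_leI)
    qed
    have cover: "X - F \<subseteq> Y n \<union> (\<Union>i. D (i + n))"
    proof
      fix x assume x: "x \<in> X - F"
      then have pos: "0 < infdist x F"
        using F \<open>F \<noteq> {}\<close> by (intro infdist_pos_not_in_closed) auto
      obtain k where k: "1 / real (Suc k) < infdist x F"
        using reals_Archimedean[OF pos] unfolding inverse_eq_divide by blast
      show "x \<in> Y n \<union> (\<Union>i. D (i + n))"
      proof (cases "x \<in> Y n")
        case False
        \<comment> \<open>minimality of \<open>l\<close> puts \<open>x\<close> in the ring of index \<open>l - 1\<close>, where \<open>l - 1 \<ge> n\<close> as \<open>x \<notin> Y n\<close>\<close>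
        define l where "l = (LEAST k. 1 / real (Suc k) < infdist x F)"
        have l: "1 / real (Suc l) < infdist x F" unfolding l_def
          using LeastI[of "\<lambda>k. 1 / real (Suc k) < infdist x F" k] k by blast
        have least: "\<not> 1 / real (Suc k) < infdist x F" if "k < l" for k
          using not_less_Least[of k] that unfolding l_def by blast
        have "n < l"
        proof (rule ccontr)
          assume "\<not> n < l"
          then have "1 / real (Suc n) \<le> 1 / real (Suc l)" by (intro divide_left_mono) auto
          with l have "1 / real (n + 1) < infdist x F" by simp
          with False x show False unfolding Y_def by blast
        qed
        then obtain i where i: "l = Suc (i + n)" 
          using less_imp_Suc_add[of n l] by (auto simp: add.commute)
        have "x \<in> D (i + n)"
          using l least[of "i + n"] x unfolding D_def i by (simp add: not_less)
        then show ?thesis by blast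
      qed simp
    qed
    have "f (X - F) \<le> f (Y n) + f (\<Union>i. D (i + n))"
      using mono[OF cover] sub2 order_trans by blast
    also have "\<dots> \<le> f (Y n) + ennreal e"
      by (intro add_mono order_refl order_trans[OF subc tail])
    finally have "f (X \<inter> F) + f (X - F) \<le> (f (X \<inter> F) + f (Y n)) + ennreal e"
      by (simp add: add.assoc add_left_mono)
    also have "f (X \<inter> F) + f (Y n) \<le> f (X \<inter> F \<union> Y n)"
    proof (rule separated)
      show "0 < 1 / real (n + 1)" by simp
      fix a b assume "a \<in> X \<inter> F" "b \<in> Y n"
      then have "infdist b F \<le> dist b a" "1 / real (n + 1) < infdist b F"
        unfolding Y_def by (blast intro: infdist_le)+
      then show "1 / real (n + 1) \<le> dist a b" by (simp only: dist_commute)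
    qed
    also have "\<dots> \<le> f X" by (intro mono) (auto simp: Y_def)
    finally show "f (X \<inter> F) + f (X - F) \<le> f X + ennreal e" by (simp add: add_right_mono)
  qed
  have "f (X \<inter> F) + f (X - F) = f X" for X
  proof (rule antisym)
    show "f (X \<inter> F) + f (X - F) \<le> f X"
      using le[of X] f0 by (cases "F = {}"; cases "f X < top") (auto simp: not_less top_unique)
    show "f X \<le> f (X \<inter> F) + f (X - F)"
      using sub2[of "X \<inter> F" "X - F"] by (simp add: Int_Diff_Un)
  qed
  then show ?thesis by (simp add: lambda_system_eq)
qed

text \<open>
  \<open>measure_of\<close> yields the zero measure unless the given set function is countably additive on the
  given sets; here countable additivity comes from Caratheodory's theorem, as the measurable sets in
  his sense form a \<open>\<sigma>\<close>-algebra that contains the closed sets.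
\<close>

lemma emeasure_measure_of_metric_outer:
  fixes f :: "'a::metric_space set \<Rightarrow> ennreal"
  assumes outer: "outer_measure_space UNIV f"
    and separated: "\<And>A B d. \<lbrakk>d > 0; \<And>a b. \<lbrakk>a \<in> A; b \<in> B\<rbrakk> \<Longrightarrow> d \<le> dist a b\<rbrakk> \<Longrightarrow> f A + f B \<le> f (A \<union> B)"
    and A: "A \<in> sets borel"
  shows "emeasure (measure_of UNIV (sets borel) f) A = f A"
proof -
  interpret sigma_algebra UNIV "UNIV :: 'a set set"
    using sigma_algebra_Pow[of "UNIV :: 'a set"] by simp
  let ?L = "lambda_system UNIV UNIV f"
  have L: "measure_space UNIV ?L f"
    by (rule caratheodory_lemma[OF outer])
  then interpret L: sigma_algebra UNIV ?L by (simp add: measure_space_def)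
  have "sets borel \<subseteq> ?L"
    using closed_in_lambda_system[OF outer separated]
    by (auto simp: borel_eq_closed intro!: L.sigma_sets_subset subsetI)
  with L have ca: "countably_additive (sets borel) f"
    by (auto simp: measure_space_def countably_additive_def)
  have "positive (sets borel) f"
    using outer by (auto simp: outer_measure_space_def positive_def)
  with ca A show ?thesis
    by (intro emeasure_measure_of_sigma) (use sets.sigma_algebra_axioms[of borel] in auto)
qed

section \<open>Hausdorff measure\<close>

definition covering_cost :: "nat \<Rightarrow> 'a::metric_space set \<Rightarrow> ennreal" where
  "covering_cost k S =
    (if S = {} then 0 else ennreal (unit_ball_vol (real k) * (diameter S / 2) ^ k))"

definition fine_cover :: "real \<Rightarrow> 'a::metric_space set \<Rightarrow> (nat \<Rightarrow> 'a set) \<Rightarrow> bool" where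
  "fine_cover e A C \<longleftrightarrow> A \<subseteq> (\<Union>j. C j) \<and> (\<forall>j. bounded (C j) \<and> diameter (C j) \<le> e)"

lemma hausdorff_pre_eq:
  "hausdorff_pre k e A = (INF C\<in>{C. fine_cover e A C}. \<Sum>j. covering_cost k (C j))"
  by (simp add: hausdorff_pre_def covering_cost_def fine_cover_def)

lemma hausdorff_pre_le: "fine_cover e A C \<Longrightarrow> hausdorff_pre k e A \<le> (\<Sum>j. covering_cost k (C j))"
  unfolding hausdorff_pre_eq by (rule INF_lower) simp

lemma le_hausdorff_pre:
  "(\<And>C. fine_cover e A C \<Longrightarrow> b \<le> (\<Sum>j. covering_cost k (C j))) \<Longrightarrow> b \<le> hausdorff_pre k e A"
  unfolding hausdorff_pre_eq by (rule INF_greatest) simp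

lemma hausdorff_pre_le_outer: "0 < e \<Longrightarrow> hausdorff_pre k e A \<le> hausdorff_outer k A"
  unfolding hausdorff_outer_def by (rule SUP_upper) simp

lemma hausdorff_pre_mono: "A \<subseteq> B \<Longrightarrow> hausdorff_pre k e A \<le> hausdorff_pre k e B"
  by (intro le_hausdorff_pre hausdorff_pre_le) (auto simp: fine_cover_def)

lemma hausdorff_pre_antimono: "d \<le> e \<Longrightarrow> hausdorff_pre k e A \<le> hausdorff_pre k d A"
  by (intro le_hausdorff_pre hausdorff_pre_le) (auto simp: fine_cover_def intro: order_trans)

lemma hausdorff_outer_mono: "A \<subseteq> B \<Longrightarrow> hausdorff_outer k A \<le> hausdorff_outer k B"
  unfolding hausdorff_outer_def by (intro SUP_mono) (auto intro: hausdorff_pre_mono)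

lemma hausdorff_outer_empty: "hausdorff_outer k {} = 0"
proof -
  have "hausdorff_pre k e {} \<le> 0" if "e > 0" for e
    using hausdorff_pre_le[of e "{}" "\<lambda>_. {}" k] that
    by (simp add: fine_cover_def covering_cost_def)
  then show ?thesis
    unfolding hausdorff_outer_def by (intro antisym SUP_least) auto
qed

text \<open>
  Countable subadditivity: merge covers of the single sets into one, giving the \<open>i\<close>-th cover the
  slack \<open>\<eta> / 2 ^ (i + 1)\<close>, so that the total loss is \<open>\<eta>\<close>.
\<close>

lemma hausdorff_pre_UN_le:
  fixes A :: "nat \<Rightarrow> 'a::metric_space set"
  shows "hausdorff_pre k e (\<Union>i. A i) \<le> (\<Sum>i. hausdorff_pre k e (A i))"
proof (rule ennreal_le_epsilon)
  fix \<eta> :: real assume fin: "(\<Sum>i. hausdorff_pre k e (A i)) < top" and "0 < \<eta>"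
  have "\<exists>C. fine_cover e (A i) C \<and>
      (\<Sum>j. covering_cost k (C j)) \<le> hausdorff_pre k e (A i) + ennreal (\<eta> * (1 / 2) ^ Suc i)" for i
  proof -
    have "hausdorff_pre k e (A i) < top"
      by (rule ennreal_suminf_lessD[OF fin])
    then have "hausdorff_pre k e (A i) < hausdorff_pre k e (A i) + ennreal (\<eta> * (1 / 2) ^ Suc i)"
      using \<open>0 < \<eta>\<close> ennreal_add_left_cancel_less[of "hausdorff_pre k e (A i)" 0] by auto
    then obtain C where "fine_cover e (A i) C"
      "(\<Sum>j. covering_cost k (C j)) < hausdorff_pre k e (A i) + ennreal (\<eta> * (1 / 2) ^ Suc i)"
      unfolding hausdorff_pre_eq[of k e "A i"] by (auto simp: INF_less_iff)
    then show ?thesis using less_imp_le by blast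
  qed
  then obtain C where cover: "\<And>i. fine_cover e (A i) (C i)"
    and cost: "\<And>i. (\<Sum>j. covering_cost k (C i j)) \<le>
      hausdorff_pre k e (A i) + ennreal (\<eta> * (1 / 2) ^ Suc i)"
    by metis
  let ?f = "\<lambda>(i, j). covering_cost k (C i j)"
  have "fine_cover e (\<Union>i. A i) (\<lambda>n. case prod_decode n of (i, j) \<Rightarrow> C i j)"
    unfolding fine_cover_def
  proof (intro conjI allI subsetI)
    fix x assume "x \<in> (\<Union>i. A i)"
    then obtain i j where "x \<in> C i j" using cover by (force simp: fine_cover_def)
    then show "x \<in> (\<Union>n. case prod_decode n of (i, j) \<Rightarrow> C i j)"
      by (intro UN_I[of "prod_encode (i, j)"]) auto
  qed (use cover in \<open>auto simp: fine_cover_def split: prod.split\<close>)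
  then have "hausdorff_pre k e (\<Union>i. A i) \<le> (\<Sum>n. covering_cost k (case prod_decode n of (i, j) \<Rightarrow> C i j))"
    by (rule hausdorff_pre_le)
  also have "\<dots> = (\<Sum>n. ?f (prod_decode n))"
    by (simp add: prod.case_distrib)
  also have "\<dots> = (\<Sum>i. \<Sum>j. covering_cost k (C i j))"
    by (rule suminf_ennreal_2dimen) simp
  also have "\<dots> \<le> (\<Sum>i. hausdorff_pre k e (A i) + ennreal (\<eta> * (1 / 2) ^ Suc i))"
    by (intro suminf_le cost summableI)
  also have "\<dots> = (\<Sum>i. hausdorff_pre k e (A i)) + (\<Sum>i. ennreal (\<eta> * (1 / 2) ^ Suc i))"
    by (intro suminf_add[symmetric] summableI)
  also have "(\<Sum>i. ennreal (\<eta> * (1 / 2) ^ Suc i)) = ennreal \<eta>"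
    using sums_mult[OF power_half_series, of \<eta>] \<open>0 < \<eta>\<close> by (intro suminf_ennreal_eq) auto
  finally show "hausdorff_pre k e (\<Union>i. A i) \<le> (\<Sum>i. hausdorff_pre k e (A i)) + ennreal \<eta>" .
qed

lemma hausdorff_outer_UN_le:
  fixes A :: "nat \<Rightarrow> 'a::metric_space set"
  shows "hausdorff_outer k (\<Union>i. A i) \<le> (\<Sum>i. hausdorff_outer k (A i))"
  unfolding hausdorff_outer_def[of k "\<Union>i. A i"]
proof (rule SUP_least)
  fix e :: real assume "e \<in> {0<..}"
  then have "(\<Sum>i. hausdorff_pre k e (A i)) \<le> (\<Sum>i. hausdorff_outer k (A i))"
    by (intro suminf_le hausdorff_pre_le_outer summableI) auto
  then show "hausdorff_pre k e (\<Union>i. A i) \<le> (\<Sum>i. hausdorff_outer k (A i))"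
    by (rule order_trans[OF hausdorff_pre_UN_le])
qed

lemma outer_measure_space_hausdorff_outer: "outer_measure_space UNIV (hausdorff_outer k)"
  by (auto simp: outer_measure_space_def positive_def increasing_def countably_subadditive_def
      hausdorff_outer_empty hausdorff_outer_UN_le intro: hausdorff_outer_mono)

text \<open>
  A covering set of diameter less than \<open>d\<close> cannot meet two sets at distance \<open>d\<close>. So a cover of
  their union falls apart into a cover of \<open>A\<close> and one of \<open>B\<close>, and no set has to be paid for
  twice.
\<close>

lemma hausdorff_pre_separated:
  fixes A B :: "'a::metric_space set"
  assumes "e < d" and sep: "\<And>a b. \<lbrakk>a \<in> A; b \<in> B\<rbrakk> \<Longrightarrow> d \<le> dist a b" and "0 < e"
  shows "hausdorff_pre k e A + hausdorff_pre k e B \<le> hausdorff_pre k e (A \<union> B)"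
proof (rule le_hausdorff_pre)
  fix C assume C: "fine_cover e (A \<union> B) C"
  define part where "part S j = (if C j \<inter> S = {} then {} else C j)" for S j
  have cover: "fine_cover e S (part S)" if "S \<subseteq> A \<union> B" for S
    using C that \<open>0 < e\<close> by (auto simp: fine_cover_def part_def) blast
  have "C j \<inter> A = {} \<or> C j \<inter> B = {}" for j
  proof (rule ccontr)
    assume "\<not> (C j \<inter> A = {} \<or> C j \<inter> B = {})"
    then obtain a b where ab: "a \<in> C j" "a \<in> A" "b \<in> C j" "b \<in> B" by blast
    then have "dist a b \<le> diameter (C j)"
      using C by (intro diameter_bounded_bound) (auto simp: fine_cover_def)
    also have "\<dots> \<le> e" using C by (auto simp: fine_cover_def)
    finally show False using sep[OF ab(2,4)] \<open>e < d\<close> by linarith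
  qed
  then have split: "covering_cost k (part A j) + covering_cost k (part B j) \<le> covering_cost k (C j)" for j
    by (auto simp: part_def covering_cost_def)
  have "hausdorff_pre k e A + hausdorff_pre k e B
      \<le> (\<Sum>j. covering_cost k (part A j)) + (\<Sum>j. covering_cost k (part B j))"
    by (intro add_mono hausdorff_pre_le cover) auto
  also have "\<dots> = (\<Sum>j. covering_cost k (part A j) + covering_cost k (part B j))"
    by (intro suminf_add summableI)
  also have "\<dots> \<le> (\<Sum>j. covering_cost k (C j))"
    by (intro suminf_le split summableI)
  finally show "hausdorff_pre k e A + hausdorff_pre k e B \<le> (\<Sum>j. covering_cost k (C j))" .
qed

lemma hausdorff_outer_separated:
  fixes A B :: "'a::metric_space set"
  assumes "d > 0" and sep: "\<And>a b. \<lbrakk>a \<in> A; b \<in> B\<rbrakk> \<Longrightarrow> d \<le> dist a b"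
  shows "hausdorff_outer k A + hausdorff_outer k B \<le> hausdorff_outer k (A \<union> B)"
proof -
  have pre: "hausdorff_pre k e1 A + hausdorff_pre k e2 B \<le> hausdorff_outer k (A \<union> B)"
    if "e1 > 0" "e2 > 0" for e1 e2
  proof -
    define e where "e = min (min e1 e2) (d / 2)"
    have e: "0 < e" "e \<le> e1" "e \<le> e2" "e < d"
      using that \<open>d > 0\<close> by (auto simp: e_def min_def)
    have "hausdorff_pre k e1 A + hausdorff_pre k e2 B \<le> hausdorff_pre k e A + hausdorff_pre k e B"
      using e by (intro add_mono hausdorff_pre_antimono)
    also have "\<dots> \<le> hausdorff_pre k e (A \<union> B)"
      using e sep by (intro hausdorff_pre_separated[of e d])
    also have "\<dots> \<le> hausdorff_outer k (A \<union> B)"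
      using e by (intro hausdorff_pre_le_outer)
    finally show ?thesis .
  qed
  have "hausdorff_pre k e1 A + hausdorff_outer k B \<le> hausdorff_outer k (A \<union> B)" if "e1 > 0" for e1
    unfolding hausdorff_outer_def[of k B] add.commute[of "hausdorff_pre k e1 A"]
    using pre[OF that]
    by (subst ennreal_SUP_add_left[symmetric]) (auto intro!: SUP_least simp: add.commute)
  then show ?thesis
    unfolding hausdorff_outer_def[of k A]
    by (subst ennreal_SUP_add_left[symmetric]) (auto intro!: SUP_least)
qed

lemma emeasure_hausdorff_measure:
  "A \<in> sets borel \<Longrightarrow> emeasure (hausdorff_measure k) A = hausdorff_outer k A"
  unfolding hausdorff_measure_def
  by (rule emeasure_measure_of_metric_outer[OF outer_measure_space_hausdorff_outer
        hausdorff_outer_separated])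

lemma sets_hausdorff_measure: "sets (hausdorff_measure k) = sets borel"
  unfolding hausdorff_measure_def using sets.sigma_sets_eq[of borel] by simp

section \<open>Hausdorff measure of sets over a hyperplane\<close>

text \<open>
  The hypothesis says that \<open>E\<close> lies on the graph of a Lipschitz function of the \<open>n - 1\<close> coordinates
  other than the \<open>i\<close>-th one. Divide the cube that contains the projection of \<open>E\<close> into
  \<open>N ^ (n - 1)\<close> cells of side proportional to \<open>1 / N\<close>. The part of \<open>E\<close> over one cell has diameter
  at most \<open>K / N\<close>, so that the powers of \<open>N\<close> cancel in the cost of this cover.
\<close>

lemma hausdorff_outer_less_top:
  fixes E :: "(real^'n) set"
  assumes "bounded E"
    and dist: "\<And>y z. \<lbrakk>y \<in> E; z \<in> E\<rbrakk> \<Longrightarrow> dist y z \<le> M * (\<Sum>l\<in>UNIV - {i}. \<bar>y $ l - z $ l\<bar>)"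
  shows "hausdorff_outer (CARD('n) - 1) E < top"
proof -
  let ?k = "CARD('n) - 1" and ?v = "unit_ball_vol (real (CARD('n) - 1))"
  obtain B where "B > 0" and B: "\<And>y. y \<in> E \<Longrightarrow> norm y < B"
    using \<open>bounded E\<close> by (metis bounded_pos_less)
  define K where "K = \<bar>M\<bar> * (real ?k * (2 * B))"
  have "K \<ge> 0" using \<open>B > 0\<close> by (simp add: K_def)
  have card: "card (UNIV - {i}) = ?k" by (simp add: card_Diff_singleton)
  have "hausdorff_pre ?k e E \<le> ennreal (?v * (K / 2) ^ ?k)" if "e > 0" for e
  proof -
    obtain N :: nat where N: "N > 0" "K / N \<le> e"
    proof -
      obtain N :: nat where "K / e < N" using reals_Archimedean2[of "K / e"] by blast
      moreover have "0 \<le> K / e" using \<open>K \<ge> 0\<close> \<open>e > 0\<close> by simp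
      ultimately have "real N > 0" by linarith
      moreover have "K < N * e"
        using \<open>e > 0\<close> \<open>K / e < N\<close> by (simp add: pos_divide_less_eq)
      ultimately have "N > 0" "K / N \<le> e"
        by (simp_all add: pos_divide_le_eq mult.commute[of e])
      then show ?thesis by (rule that)
    qed
    \<comment> \<open>\<open>s\<close> rescales \<open>[-B, B]\<close> to \<open>[0, N]\<close>; the integer parts of the rescaled coordinates name the cell\<close>
    define s where "s t = (t + B) * N / (2 * B)" for t
    define idx where "idx y = (\<lambda>l\<in>UNIV - {i}. nat \<lfloor>s (y $ l)\<rfloor>)" for y :: "real^'n"
    let ?I = "PiE (UNIV - {i}) (\<lambda>_. {..<N})"
    have range: "0 \<le> s (y $ l) \<and> s (y $ l) < N" if "y \<in> E" for y l
    proof -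
      have "\<bar>y $ l\<bar> < B" using component_le_norm_cart[of y l] B[OF that] by linarith
      then have "0 \<le> (y $ l + B) / (2 * B)" "(y $ l + B) / (2 * B) < 1"
        using \<open>B > 0\<close> by (auto simp: field_simps)
      then have "0 \<le> (y $ l + B) / (2 * B) * N \<and> (y $ l + B) / (2 * B) * real N < 1 * real N"
        using N(1) by (intro conjI mult_nonneg_nonneg mult_strict_right_mono) simp_all
      then show ?thesis by (simp add: s_def)
    qed
    have idx: "idx y \<in> ?I" if "y \<in> E" for y
      using range[OF that] by (auto simp: idx_def floor_less_iff nat_less_iff)
    have close: "dist y z \<le> K / N" if "y \<in> E" "z \<in> E" "idx y = idx z" for y z
    proof -
      have "\<bar>y $ l - z $ l\<bar> \<le> 2 * B / N" if "l \<in> UNIV - {i}" for l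
      proof -
        have "nat \<lfloor>s (y $ l)\<rfloor> = nat \<lfloor>s (z $ l)\<rfloor>"
          using fun_cong[OF \<open>idx y = idx z\<close>, of l] \<open>l \<in> UNIV - {i}\<close> by (simp add: idx_def)
        then have "\<lfloor>s (y $ l)\<rfloor> = \<lfloor>s (z $ l)\<rfloor>"
          using range[OF \<open>y \<in> E\<close>, of l] range[OF \<open>z \<in> E\<close>, of l] by (auto simp: nat_eq_iff)
        then have "\<bar>s (y $ l) - s (z $ l)\<bar> \<le> 1" by linarith
        moreover have "s (y $ l) - s (z $ l) = (y $ l - z $ l) * (N / (2 * B))"
          by (simp add: s_def algebra_simps diff_divide_distrib add_divide_distrib)
        ultimately have "\<bar>y $ l - z $ l\<bar> * (N / (2 * B)) \<le> 1"
          using \<open>B > 0\<close> by (simp add: abs_mult)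
        then show ?thesis using \<open>B > 0\<close> N(1) by (simp add: field_simps)
      qed
      then have "(\<Sum>l\<in>UNIV - {i}. \<bar>y $ l - z $ l\<bar>) \<le> real ?k * (2 * B / N)"
        using sum_bounded_above[of "UNIV - {i}" "\<lambda>l. \<bar>y $ l - z $ l\<bar>" "2 * B / N"] by (simp add: card)
      then have "\<bar>M\<bar> * (\<Sum>l\<in>UNIV - {i}. \<bar>y $ l - z $ l\<bar>) \<le> K / N"
        unfolding K_def by (metis abs_ge_zero mult_left_mono times_divide_eq_right)
      moreover have "M * (\<Sum>l\<in>UNIV - {i}. \<bar>y $ l - z $ l\<bar>) \<le> \<bar>M\<bar> * (\<Sum>l\<in>UNIV - {i}. \<bar>y $ l - z $ l\<bar>)"
        by (intro mult_right_mono sum_nonneg) auto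
      ultimately show ?thesis using dist[OF that(1,2)] by linarith
    qed
    have "finite ?I" by (intro finite_PiE) auto
    moreover have cardI: "card ?I = N ^ ?k" by (simp add: card_PiE card)
    ultimately obtain h where h: "bij_betw h {0..<N ^ ?k} ?I"
      using ex_bij_betw_nat_finite by metis
    define C where "C j = (if j < N ^ ?k then {y \<in> E. idx y = h j} else {})" for j
    have diam: "diameter (C j) \<le> K / N" for j
      using close \<open>K \<ge> 0\<close>
      by (intro diameter_le) (auto simp: C_def dist_norm[symmetric] split: if_splits)
    have "fine_cover e E C"
      unfolding fine_cover_def
    proof (intro conjI allI subsetI)
      fix y assume "y \<in> E"
      then have "idx y \<in> h ` {0..<N ^ ?k}"
        using idx h by (simp only: bij_betw_imp_surj_on)
      then obtain j where "j < N ^ ?k" "idx y = h j"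
        by (elim imageE) simp
      then show "y \<in> (\<Union>j. C j)" using \<open>y \<in> E\<close> by (auto simp: C_def)
    next
      show "bounded (C j)" for j
        using \<open>bounded E\<close> by (rule bounded_subset) (auto simp: C_def)
      show "diameter (C j) \<le> e" for j using diam[of j] N(2) by linarith
    qed
    then have "hausdorff_pre ?k e E \<le> (\<Sum>j. covering_cost ?k (C j))"
      by (rule hausdorff_pre_le)
    also have "\<dots> = (\<Sum>j<N ^ ?k. covering_cost ?k (C j))"
      by (rule suminf_finite) (auto simp: C_def covering_cost_def)
    also have "\<dots> \<le> (\<Sum>j<N ^ ?k. ennreal (?v * (K / N / 2) ^ ?k))"
    proof (rule sum_mono)
      fix j
      have "bounded (C j)" using \<open>bounded E\<close> by (rule bounded_subset) (auto simp: C_def)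
      then show "covering_cost ?k (C j) \<le> ennreal (?v * (K / N / 2) ^ ?k)"
        using diam[of j] diameter_ge_0[of "C j"]
        by (auto simp: covering_cost_def intro!: ennreal_leI mult_left_mono power_mono)
    qed
    also have "\<dots> = ennreal (real (N ^ ?k) * (?v * (K / N / 2) ^ ?k))"
      using \<open>K \<ge> 0\<close> by (simp add: ennreal_mult ennreal_of_nat_eq_real_of_nat)
    also have "real (N ^ ?k) * (?v * (K / N / 2) ^ ?k) = ?v * (K / 2) ^ ?k"
      using N(1) by (simp add: power_divide field_simps)
    finally show ?thesis .
  qed
  then have "hausdorff_outer ?k E \<le> ennreal (?v * (K / 2) ^ ?k)"
    unfolding hausdorff_outer_def by (auto intro!: SUP_least)
  then show ?thesis by (rule le_less_trans) simp
qed

text \<open>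
  The lower bound comes from Lebesgue measure on the full space. Project the sets of a cover of
  \<open>E\<close> along the \<open>i\<close>-th axis and thicken the projections to height \<open>2 * \<sigma>\<close> in that direction. The resulting cylinders cover the ball. A covering set of diameter
  \<open>d\<close> gives a cylinder inside a box of volume \<open>2 * \<sigma> * (2 * d) ^ (n - 1)\<close>, which is a constant
  multiple of the cost of the set. So no cover can be cheaper than a fixed multiple of the volume of the
  ball.
\<close>

lemma hausdorff_outer_pos:
  fixes E :: "(real^'n) set"
  assumes "\<sigma> > 0"
    and proj: "\<And>x. x \<in> ball p \<sigma> \<Longrightarrow> \<exists>y\<in>E. \<forall>l. l \<noteq> i \<longrightarrow> y $ l = x $ l"
  shows "0 < hausdorff_outer (CARD('n) - 1) E"
proof -
  let ?k = "CARD('n) - 1" and ?v = "unit_ball_vol (real (CARD('n) - 1))"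
  have card: "card (UNIV - {i}) = ?k" by (simp add: card_Diff_singleton)
  \<comment> \<open>chosen such that \<open>2 * \<sigma> * (2 * d) ^ k\<close> is \<open>c\<close> times the cost of a set of diameter \<open>d\<close>\<close>
  define c where "c = 2 * \<sigma> * 4 ^ ?k / ?v"
  have "c > 0" using \<open>\<sigma> > 0\<close> by (simp add: c_def)
  define V where "V = measure lborel (ball p \<sigma>)"
  have V: "emeasure lborel (ball p \<sigma>) = ennreal V"
    unfolding V_def 
    using emeasure_lborel_ball_finite[of p \<sigma>] by (intro emeasure_eq_ennreal_measure) auto
  have "V > 0" using \<open>\<sigma> > 0\<close> by (simp add: V_def content_ball_pos)
  have "ennreal (V / c) \<le> hausdorff_pre ?k 1 E"
  proof (rule le_hausdorff_pre)
    fix C assume C: "fine_cover 1 E C"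
    define T where "T j = (if C j = {} then {} else
      let q = (SOME q. q \<in> C j) in
      cbox (\<chi> l. if l = i then p $ i - \<sigma> else q $ l - diameter (C j))
           (\<chi> l. if l = i then p $ i + \<sigma> else q $ l + diameter (C j)))" for j
    have meas: "emeasure lborel (T j) \<le> ennreal c * covering_cost ?k (C j)" for j
    proof (cases "C j = {}")
      case False
      define q where "q = (SOME q. q \<in> C j)"
      define d where "d = diameter (C j)"
      have "d \<ge> 0" using C by (auto simp: d_def fine_cover_def intro!: diameter_ge_0)
      define a where "a = (\<chi> l. if l = i then p $ i - \<sigma> else q $ l - d)"
      define b where "b = (\<chi> l. if l = i then p $ i + \<sigma> else q $ l + d)"
      have T: "T j = cbox a b" using False unfolding T_def Let_def q_def d_def a_def b_def by simp
      have "cbox a b \<noteq> {}"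
        using \<open>d \<ge> 0\<close> \<open>\<sigma> > 0\<close> by (auto simp: interval_ne_empty_cart a_def b_def)
      then have "measure lborel (cbox a b) = (\<Prod>l\<in>UNIV. b $ l - a $ l)"
        by (rule content_cbox_cart)
      also have "\<dots> = (b $ i - a $ i) * (\<Prod>l\<in>UNIV - {i}. b $ l - a $ l)"
        by (rule prod.remove) auto
      also have "(\<Prod>l\<in>UNIV - {i}. b $ l - a $ l) = (\<Prod>l\<in>UNIV - {i}. 2 * d)"
        by (rule prod.cong) (auto simp: a_def b_def)
      also have "(b $ i - a $ i) * (\<Prod>l\<in>UNIV - {i}. 2 * d) = c * (?v * (d / 2) ^ ?k)"
      proof -
        have "(2 * d) ^ ?k = 4 ^ ?k * (d / 2) ^ ?k"
          using power_mult_distrib[of 4 "d / 2" ?k] by simp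
        moreover have "?v \<noteq> 0" using unit_ball_vol_pos[of "real ?k"] by linarith
        ultimately show ?thesis unfolding a_def b_def c_def prod_constant card
          by (simp del: unit_ball_vol_pos power_mult_distrib)
      qed
      finally have "emeasure lborel (T j) = ennreal (c * (?v * (d / 2) ^ ?k))"
        unfolding T using emeasure_lborel_cbox_finite[of a b]
        by (subst emeasure_eq_ennreal_measure) auto
      then show ?thesis
        using False \<open>c > 0\<close> \<open>d \<ge> 0\<close> by (simp add: covering_cost_def d_def ennreal_mult)
    qed (simp add: T_def)
    have "ball p \<sigma> \<subseteq> (\<Union>j. T j)"
    proof
      fix x assume x: "x \<in> ball p \<sigma>"
      then obtain y where "y \<in> E" and y: "\<And>l. l \<noteq> i \<Longrightarrow> y $ l = x $ l" using proj[OF x] by blast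
      then obtain j where j: "y \<in> C j" using C by (auto simp: fine_cover_def)
      define q where "q = (SOME q. q \<in> C j)"
      have "q \<in> C j" unfolding q_def using j by (rule someI)
      then have "dist y q \<le> diameter (C j)"
        using C j by (intro diameter_bounded_bound) (auto simp: fine_cover_def)
      then have "\<bar>y $ l - q $ l\<bar> \<le> diameter (C j)" for l
        using component_le_norm_cart[of "y - q" l] by (simp add: dist_norm)
      then have 1: "\<bar>x $ l - q $ l\<bar> \<le> diameter (C j)" if "l \<noteq> i" for l
        using y[OF that] by metis
      have 2: "\<bar>x $ i - p $ i\<bar> \<le> \<sigma>"
        using component_le_norm_cart[of "x - p" i] x by (simp add: dist_norm norm_minus_commute)
      have "x \<in> T j"
        using j 1 2
        by (auto simp: T_def Let_def q_def[symmetric] mem_box_cart abs_le_iff algebra_simps)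
      then show "x \<in> (\<Union>j. T j)" by blast
    qed
    moreover have Tm: "T j \<in> sets lborel" for j by (simp add: T_def Let_def)
    ultimately have "ennreal V \<le> emeasure lborel (\<Union>j. T j)"
      unfolding V[symmetric] by (intro emeasure_mono) auto
    also have "\<dots> \<le> (\<Sum>j. emeasure lborel (T j))"
      using Tm by (intro emeasure_subadditive_countably) auto
    also have "\<dots> \<le> (\<Sum>j. ennreal c * covering_cost ?k (C j))"
      by (intro suminf_le meas summableI)
    also have "\<dots> = ennreal c * (\<Sum>j. covering_cost ?k (C j))" by simp
    finally have "ennreal (1 / c) * ennreal V \<le> ennreal (1 / c) * (ennreal c * (\<Sum>j. covering_cost ?k (C j)))"
      by (rule mult_left_mono) simp
    then show "ennreal (V / c) \<le> (\<Sum>j. covering_cost ?k (C j))"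
      using \<open>c > 0\<close> \<open>V > 0\<close> by (simp add: mult.assoc[symmetric] ennreal_mult[symmetric])
  qed
  also have "\<dots> \<le> hausdorff_outer ?k E" by (rule hausdorff_pre_le_outer) simp
  finally show ?thesis using \<open>V > 0\<close> \<open>c > 0\<close> by (auto simp: ennreal_zero_less_divide elim: order.strict_trans2[rotated])
qed

section \<open>Surface measure of smooth boundaries\<close>

text \<open>
  The partial derivatives are again differentiable, hence continuous and bounded on the compact set.
  They bound the operator norm of the derivative, and the mean value inequality applies.
\<close>

lemma C_infinity_lipschitz_on_compact_convex:
  fixes g :: "'a::euclidean_space \<Rightarrow> real"
  assumes "C_infinity g" "compact S" "convex S"
  obtains L where "L \<ge> 0" "\<And>x y. \<lbrakk>x \<in> S; y \<in> S\<rbrakk> \<Longrightarrow> \<bar>g x - g y\<bar> \<le> L * norm (x - y)"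
proof -
  let ?D = "\<lambda>x. frechet_derivative g (at x)"
  have "C_k (Suc 0) g" using assms(1) by (simp only: C_infinity_def)
  then have diff: "\<And>x. g differentiable (at x)"
    and cont: "\<And>b. b \<in> Basis \<Longrightarrow> continuous_on UNIV (\<lambda>x. ?D x b)"
    by simp_all
  have "continuous_on S (\<lambda>x. \<Sum>b\<in>Basis. \<bar>?D x b\<bar>)"
    using cont by (intro continuous_intros continuous_on_subset[OF cont]) auto
  then have "bounded ((\<lambda>x. \<Sum>b\<in>Basis. \<bar>?D x b\<bar>) ` S)"
    using assms(2) by (intro compact_imp_bounded compact_continuous_image)
  then obtain L where "L > 0" and L: "\<And>x. x \<in> S \<Longrightarrow> (\<Sum>b\<in>Basis. \<bar>?D x b\<bar>) \<le> L"
    unfolding bounded_pos by (auto simp: abs_of_nonneg sum_nonneg)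
  have deriv: "(g has_derivative ?D x) (at x)" for x
    using diff by (simp add: frechet_derivative_works)
  have "onorm (?D x) \<le> L" if "x \<in> S" for x
  proof (rule onorm_le)
    fix h
    have lin: "linear (?D x)" by (rule has_derivative_linear[OF deriv])
    have "?D x h = ?D x (\<Sum>b\<in>Basis. (h \<bullet> b) *\<^sub>R b)" by (simp add: euclidean_representation)
    also have "\<dots> = (\<Sum>b\<in>Basis. (h \<bullet> b) * ?D x b)"
      by (simp add: linear_sum[OF lin] linear_cmul[OF lin])
    finally have "norm (?D x h) \<le> (\<Sum>b\<in>Basis. norm ((h \<bullet> b) * ?D x b))"
      by (simp only: norm_sum)
    also have "\<dots> \<le> (\<Sum>b\<in>Basis. norm h * \<bar>?D x b\<bar>)"
      by (intro sum_mono) (simp add: abs_mult Basis_le_norm mult_right_mono)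
    also have "\<dots> \<le> norm h * L"
      using L[OF that] by (simp add: sum_distrib_left[symmetric] mult_left_mono)
    finally show "norm (?D x h) \<le> L * norm h" by (simp add: mult.commute)
  qed
  then have "norm (g x - g y) \<le> L * norm (x - y)" if "x \<in> S" "y \<in> S" for x y
    using differentiable_bound[OF assms(3) has_derivative_at_withinI[OF deriv] _ that] by blast
  then show ?thesis using that[of L] \<open>L > 0\<close> by simp
qed

text \<open>
  The sets above and below the graph are open, and one of them lies in \<open>\<Omega>\<close>, the other one outside, so the
  frontier can only meet the graph. Conversely, moving a point of the graph slightly along the axis leads
  into \<open>\<Omega>\<close>.
\<close>

lemma frontier_iff_on_graph:
  fixes \<Omega> :: "(real^'n) set"
  assumes \<Omega>: "\<Omega> \<inter> ball p r = {x \<in> ball p r. s * x $ i > g x}"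
    and s: "s \<in> {-1, 1::real}"
    and cont: "continuous_on UNIV g"
    and inv: "\<And>x t. g (x + t *\<^sub>R axis i 1) = g x"
    and y: "y \<in> ball p r"
  shows "y \<in> frontier \<Omega> \<longleftrightarrow> s * y $ i = g y"
proof
  have cont': "continuous_on UNIV (\<lambda>x. s * x $ i - g x)"
    by (intro continuous_intros cont)
  show "s * y $ i = g y" if "y \<in> frontier \<Omega>"
  proof (rule ccontr)
    assume "s * y $ i \<noteq> g y"
    then consider "s * y $ i > g y" | "s * y $ i < g y" by linarith
    then show False
    proof cases
      case 1
      let ?U = "ball p r \<inter> {x. 0 < s * x $ i - g x}"
      have "open ?U"
        using cont' by (intro open_Int open_ball open_Collect_less continuous_on_const)
      moreover have "y \<in> ?U" using y 1 by simp
      moreover have "?U \<subseteq> \<Omega> \<inter> ball p r" unfolding \<Omega> by auto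
      then have "?U \<subseteq> \<Omega>" by blast
      ultimately have "y \<in> interior \<Omega>" by (rule interiorI)
      with that show False by (simp add: frontier_def)
    next
      case 2
      let ?U = "ball p r \<inter> {x. s * x $ i - g x < 0}"
      have "open ?U"
        using cont' by (intro open_Int open_ball open_Collect_less continuous_on_const)
      moreover have "?U \<inter> \<Omega> = {}"
      proof -
        have False if "x \<in> ball p r" "x \<in> \<Omega>" "s * x $ i - g x < 0" for x
        proof -
          have "x \<in> \<Omega> \<inter> ball p r" using that by blast
          then show False using that(3) unfolding \<Omega> by simp
        qed
        then show ?thesis by blast
      qed
      ultimately have "?U \<inter> closure \<Omega> = {}" by (simp add: open_Int_closure_eq_empty)
      with that 2 y show False by (auto simp: frontier_def)
    qed
  qed
  show "y \<in> frontier \<Omega>" if eq: "s * y $ i = g y"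
  proof -
    have "y \<notin> \<Omega> \<inter> ball p r" unfolding \<Omega> using eq by simp
    then have "y \<notin> \<Omega>" using y by blast
    then have "y \<notin> interior \<Omega>" using interior_subset by blast
    moreover have "y \<in> closure \<Omega>"
      unfolding closure_approachable
    proof (intro allI impI)
      fix e :: real assume "0 < e"
      \<comment> \<open>a step short enough to stay both within \<open>e\<close> of \<open>y\<close> and inside the ball around \<open>p\<close>\<close>
      define t where "t = min e (r - dist p y) / 2"
      have t: "0 < t" "t < e" "t < r - dist p y"
        using \<open>0 < e\<close> y by (auto simp: t_def)
      define z where "z = y + (t * s) *\<^sub>R axis i 1"
      have "\<bar>s\<bar> = 1" "s * s = 1" using s by auto
      have dz: "dist z y = t" using t(1) \<open>\<bar>s\<bar> = 1\<close>
        by (simp add: z_def dist_norm abs_mult norm_axis_1)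
      then have "z \<in> ball p r"
        using dist_triangle[of p z y] t(3) by (simp add: dist_commute)
      moreover have "s * z $ i = s * y $ i + t"
        using \<open>s * s = 1\<close> by (simp add: z_def axis_def algebra_simps)
      then have "s * z $ i > g z"
        using inv[of y "t * s"] t(1) eq by (simp add: z_def)
      ultimately have "z \<in> \<Omega> \<inter> ball p r" unfolding \<Omega> by simp
      then show "\<exists>x\<in>\<Omega>. dist x y < e" using dz t(2) by auto
    qed
    ultimately show ?thesis by (simp add: frontier_def)
  qed
qed

lemma smooth_boundaryE:
  fixes \<Omega> :: "(real^'n) set"
  assumes "smooth_boundary \<Omega>" "p \<in> frontier \<Omega>"
  obtains r i s and g :: "real^'n \<Rightarrow> real"
  where "r > 0" "\<bar>s\<bar> = 1" "C_infinity g" "\<And>x t. g (x + t *\<^sub>R axis i 1) = g x"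
    "\<And>y. y \<in> ball p r \<Longrightarrow> y \<in> frontier \<Omega> \<longleftrightarrow> s * y $ i = g y"
  using bspec[OF assms(1)[unfolded smooth_boundary_def] assms(2)]
proof (elim exE conjE bexE)
  fix r i s and g :: "real^'n \<Rightarrow> real"
  assume "r > 0" and s: "s \<in> {-1, 1}" and smooth: "C_infinity g"
    and inv: "\<forall>x t. g (x + t *\<^sub>R axis i 1) = g x"
    and \<Omega>: "\<Omega> \<inter> ball p r = {x \<in> ball p r. s * x $ i > g x}"
  have "C_k 0 g" using smooth by (simp only: C_infinity_def)
  then have "continuous_on UNIV g" by simp
  then have "y \<in> frontier \<Omega> \<longleftrightarrow> s * y $ i = g y" if "y \<in> ball p r" for y
    using inv that by (intro frontier_iff_on_graph[OF \<Omega> s]) auto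
  moreover have "\<bar>s\<bar> = 1" using s by auto
  ultimately show ?thesis
    using \<open>r > 0\<close> smooth inv by (intro that[of r s g i]) auto
qed

lemma sets_surface_measure: "sets surface_measure = sets borel"
  by (simp add: surface_measure_def sets_hausdorff_measure)

lemma emeasure_surface_measure:
  fixes E :: "(real^'n) set"
  shows "E \<in> sets borel \<Longrightarrow> emeasure surface_measure E = hausdorff_outer (CARD('n) - 1) E"
  by (simp add: surface_measure_def emeasure_hausdorff_measure)

text \<open>
  On the graph the differences of the \<open>i\<close>-th coordinates are Lipschitz in those of the other coordinates, which
  is what the covering by a grid requires.
\<close>

lemma frontier_locally_finite_surface:
  fixes \<Omega> :: "(real^'n) set"
  assumes "smooth_boundary \<Omega>" "p \<in> frontier \<Omega>"
  shows "\<exists>r>0. emeasure surface_measure (frontier \<Omega> \<inter> ball p r) < top"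
proof -
  obtain r i s and g :: "real^'n \<Rightarrow> real" where "r > 0" and s: "\<bar>s\<bar> = 1" and smooth: "C_infinity g"
    and inv: "\<And>x t. g (x + t *\<^sub>R axis i 1) = g x"
    and graph: "\<And>y. y \<in> ball p r \<Longrightarrow> y \<in> frontier \<Omega> \<longleftrightarrow> s * y $ i = g y"
    using smooth_boundaryE[OF assms] by metis
  let ?Q = "cbox (\<chi> l. p $ l - r) (\<chi> l. p $ l + r)"
  obtain L where "L \<ge> 0" and L: "\<And>x y. \<lbrakk>x \<in> ?Q; y \<in> ?Q\<rbrakk> \<Longrightarrow> \<bar>g x - g y\<bar> \<le> L * norm (x - y)"
    using C_infinity_lipschitz_on_compact_convex[OF smooth, of ?Q] by auto
  have "hausdorff_outer (CARD('n) - 1) (frontier \<Omega> \<inter> ball p r) < top"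
  proof (rule hausdorff_outer_less_top)
    show "bounded (frontier \<Omega> \<inter> ball p r)" by (simp add: bounded_Int)
    fix y z assume y: "y \<in> frontier \<Omega> \<inter> ball p r" and z: "z \<in> frontier \<Omega> \<inter> ball p r"
    let ?\<Sigma> = "\<Sum>l\<in>UNIV - {i}. \<bar>y $ l - z $ l\<bar>"
    \<comment> \<open>\<open>z'\<close> has the same height over the hyperplane as \<open>y\<close>, and \<open>g\<close> does not see the difference to \<open>z\<close>\<close>
    define z' where "z' = z + (y $ i - z $ i) *\<^sub>R axis i 1"
    have z'_nth: "z' $ l = (if l = i then y $ i else z $ l)" for l
      by (simp add: z'_def axis_def)
    have near: "\<bar>w $ l - p $ l\<bar> \<le> r" if "w \<in> ball p r" for w l
      using component_le_norm_cart[of "w - p" l] that by (simp add: dist_norm norm_minus_commute)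
    have "\<bar>y $ l - p $ l\<bar> \<le> r" "\<bar>z' $ l - p $ l\<bar> \<le> r" for l
      using near[of y] near[of z] y z by (auto simp: z'_nth)
    then have "y \<in> ?Q" "z' \<in> ?Q"
      by (auto simp: mem_box_cart abs_le_iff algebra_simps)
    then have "\<bar>g y - g z'\<bar> \<le> L * norm (y - z')" by (rule L)
    also have "norm (y - z') \<le> (\<Sum>l\<in>UNIV. \<bar>(y - z') $ l\<bar>)" by (rule norm_le_l1_cart)
    also have "\<dots> = \<bar>(y - z') $ i\<bar> + (\<Sum>l\<in>UNIV - {i}. \<bar>(y - z') $ l\<bar>)"
      by (rule sum.remove) auto
    also have "\<dots> = ?\<Sigma>" by (simp add: z'_nth)
    finally have "\<bar>g y - g z'\<bar> \<le> L * ?\<Sigma>" using \<open>L \<ge> 0\<close> by (simp add: mult_left_mono)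
    moreover have "g y = s * y $ i" "g z' = s * z $ i"
      using graph[of y] graph[of z] y z inv[of z] by (auto simp: z'_def)
    then have "\<bar>g y - g z'\<bar> = \<bar>y $ i - z $ i\<bar>"
      using s by (metis abs_mult mult_1 right_diff_distrib)
    moreover have "dist y z \<le> \<bar>(y - z) $ i\<bar> + (\<Sum>l\<in>UNIV - {i}. \<bar>(y - z) $ l\<bar>)"
      unfolding dist_norm using norm_le_l1_cart[of "y - z"] by (subst (asm) sum.remove[of _ i]) auto
    ultimately show "dist y z \<le> (L + 1) * ?\<Sigma>" by (simp add: algebra_simps)
  qed
  then show ?thesis
    using \<open>r > 0\<close> by (subst emeasure_surface_measure) (auto intro!: exI[of _ r])
qed

text \<open>
  This is what makes bounded functions integrable over the boundary; Bochner integrals of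
  functions that are not integrable would be \<open>0\<close>.
\<close>

lemma emeasure_frontier_finite:
  fixes \<Omega> :: "(real^'n) set"
  assumes "smooth_boundary \<Omega>" "bounded \<Omega>"
  shows "emeasure surface_measure (frontier \<Omega>) < top"
proof -
  have "\<forall>p\<in>frontier \<Omega>. \<exists>r>0. emeasure surface_measure (frontier \<Omega> \<inter> ball p r) < top"
    using frontier_locally_finite_surface[OF assms(1)] by blast
  then obtain \<rho> where "\<forall>p\<in>frontier \<Omega>. \<rho> p > 0 \<and>
      emeasure surface_measure (frontier \<Omega> \<inter> ball p (\<rho> p)) < top"
    by (rule bchoice[THEN exE])
  then have \<rho>: "\<And>p. p \<in> frontier \<Omega> \<Longrightarrow> \<rho> p > 0"
    "\<And>p. p \<in> frontier \<Omega> \<Longrightarrow> emeasure surface_measure (frontier \<Omega> \<inter> ball p (\<rho> p)) < top"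
    by blast+
  have "compact (frontier \<Omega>)" using assms(2) by (rule compact_frontier_bounded)
  then obtain F where F: "F \<subseteq> frontier \<Omega>" "finite F" "frontier \<Omega> \<subseteq> (\<Union>p\<in>F. ball p (\<rho> p))"
  proof (rule compactE_image)
    show "frontier \<Omega> \<subseteq> (\<Union>p\<in>frontier \<Omega>. ball p (\<rho> p))" using \<rho>(1) by force
  qed auto
  have "emeasure surface_measure (frontier \<Omega>)
      \<le> emeasure surface_measure (\<Union>p\<in>F. frontier \<Omega> \<inter> ball p (\<rho> p))"
  proof (rule emeasure_mono)
    show "frontier \<Omega> \<subseteq> (\<Union>p\<in>F. frontier \<Omega> \<inter> ball p (\<rho> p))" using F(3) by blast
    show "(\<Union>p\<in>F. frontier \<Omega> \<inter> ball p (\<rho> p)) \<in> sets surface_measure"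
      unfolding sets_surface_measure using F(2)
      by (intro sets.finite_UN sets.Int borel_closed borel_open frontier_closed open_ball)
  qed
  also have "\<dots> \<le> (\<Sum>p\<in>F. emeasure surface_measure (frontier \<Omega> \<inter> ball p (\<rho> p)))"
    using F(2) by (intro emeasure_subadditive_finite) (auto simp: sets_surface_measure)
  also have "\<dots> < top" using F \<rho>(2) by (simp add: ennreal_sum_less_top subset_iff)
  finally show ?thesis .
qed

text \<open>
  As the graph is that of a continuous function, points near \<open>p\<close> are projected to points of the graph that are still near \<open>p\<close>. So the
  projection of the boundary part along the axis covers that of a ball.
\<close>

lemma emeasure_frontier_ball_pos:
  fixes \<Omega> :: "(real^'n) set"
  assumes "smooth_boundary \<Omega>" "p \<in> frontier \<Omega>" "e > 0"
  shows "0 < emeasure surface_measure (frontier \<Omega> \<inter> ball p e)"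
proof -
  obtain r i s and g :: "real^'n \<Rightarrow> real" where "r > 0" and s: "\<bar>s\<bar> = 1" and smooth: "C_infinity g"
    and inv: "\<And>x t. g (x + t *\<^sub>R axis i 1) = g x"
    and graph: "\<And>y. y \<in> ball p r \<Longrightarrow> y \<in> frontier \<Omega> \<longleftrightarrow> s * y $ i = g y"
    using smooth_boundaryE[OF assms(1,2)] by metis
  have ss: "s * (s * a) = a" for a using s by (cases "s \<ge> 0") auto
  have "C_k 0 g" using smooth by (simp only: C_infinity_def)
  then have cont: "continuous_on UNIV g" by simp
  \<comment> \<open>the projection onto the graph along the \<open>i\<close>-th axis, which fixes \<open>p\<close>\<close>
  define \<phi> where "\<phi> x = x + (s * g x - x $ i) *\<^sub>R axis i 1" for x
  have "continuous_on UNIV \<phi>" unfolding \<phi>_def by (intro continuous_intros cont)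
  moreover have "\<phi> p = p"
    using graph[of p] \<open>r > 0\<close> assms(2) ss[of "p $ i"] by (simp add: \<phi>_def)
  ultimately obtain \<sigma> where "\<sigma> > 0" and \<sigma>: "\<And>x. dist x p < \<sigma> \<Longrightarrow> dist (\<phi> x) p < min e r"
    unfolding continuous_on_iff using \<open>r > 0\<close> \<open>e > 0\<close>
    by (elim ballE[of _ _ p] allE[of _ "min e r"]) auto
  have "0 < hausdorff_outer (CARD('n) - 1) (frontier \<Omega> \<inter> ball p e)"
  proof (rule hausdorff_outer_pos[OF \<open>\<sigma> > 0\<close>])
    fix x assume "x \<in> ball p \<sigma>"
    then have "dist (\<phi> x) p < min e r" by (intro \<sigma>) (simp add: dist_commute)
    then have ball: "\<phi> x \<in> ball p e" "\<phi> x \<in> ball p r" by (simp_all add: dist_commute)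
    have "s * \<phi> x $ i = g (\<phi> x)"
      using inv[of x] ss[of "g x"] by (simp add: \<phi>_def axis_def)
    then have "\<phi> x \<in> frontier \<Omega>" using graph[OF ball(2)] by simp
    with ball(1) show "\<exists>y\<in>frontier \<Omega> \<inter> ball p e. \<forall>l. l \<noteq> i \<longrightarrow> y $ l = x $ l"
      by (intro bexI[of _ "\<phi> x"]) (auto simp: \<phi>_def axis_def)
  qed
  then show ?thesis by (subst emeasure_surface_measure) auto
qed

section \<open>Integrals of the kernels\<close>

text \<open>
  A profile is only controlled on \<open>[0,\<infinity>)\<close>. Cutting it off below \<open>0\<close> gives a function with the same
  values at all arguments that occur in the kernels, but measurable, bounded and integrable on the whole line.
\<close>

lemma kernel_profileE:
  assumes "kernel_profile R"
  obtains R\<^sub>0 B \<gamma> where "R\<^sub>0 \<in> borel_measurable borel" "\<And>r. r \<ge> 0 \<Longrightarrow> R\<^sub>0 r = R r"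
    "\<And>r. 0 \<le> R\<^sub>0 r" "\<And>r. R\<^sub>0 r \<le> B" "integrable lborel R\<^sub>0"
    "\<gamma> > 0" "\<And>r. r \<in> {0..1/2} \<Longrightarrow> \<gamma> \<le> R\<^sub>0 r"
proof -
  obtain R' where deriv: "\<forall>r\<in>{0..1}. (R has_real_derivative R' r) (at r within {0..1})"
    and nonneg: "\<forall>r\<ge>0. R r \<ge> 0" and zero: "\<forall>r>1. R r = 0"
    and low: "\<exists>\<gamma>>0. \<forall>r\<in>{0..1/2}. R r \<ge> \<gamma>"
    using assms unfolding kernel_profile_def by blast
  obtain \<gamma> where "\<gamma> > 0" and \<gamma>: "\<forall>r\<in>{0..1/2}. R r \<ge> \<gamma>" using low by blast
  have cont: "continuous_on {0..1} R"
    using deriv by (intro DERIV_continuous_on) blast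
  define R\<^sub>0 where "R\<^sub>0 r = indicator {0..1} r *\<^sub>R R r" for r :: real
  have meas: "R\<^sub>0 \<in> borel_measurable borel"
    unfolding R\<^sub>0_def by (rule borel_measurable_continuous_on_indicator[OF _ cont]) simp
  have "bounded (R ` {0..1})"
    using cont by (intro compact_imp_bounded compact_continuous_image) auto
  then obtain B where "B > 0" and B: "\<And>r. r \<in> {0..1} \<Longrightarrow> \<bar>R r\<bar> \<le> B"
    unfolding bounded_pos by auto
  have agree: "R\<^sub>0 r = R r" if "r \<ge> 0" for r
    using that zero by (cases "r \<le> 1") (simp_all add: R\<^sub>0_def)
  have "0 \<le> R\<^sub>0 r" for r
    using nonneg by (simp add: R\<^sub>0_def indicator_def)
  moreover have "R\<^sub>0 r \<le> B" for r
    using B[of r] \<open>B > 0\<close> by (auto simp: R\<^sub>0_def indicator_def)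
  moreover have "integrable lborel R\<^sub>0"
    unfolding R\<^sub>0_def using cont
    by (metis borel_integrable_atLeastAtMost' set_integrable_def)
  moreover have "\<gamma> \<le> R\<^sub>0 r" if "r \<in> {0..1/2}" for r
    using \<gamma> that agree[of r] by simp
  ultimately show ?thesis using that meas agree \<open>\<gamma> > 0\<close> by blast
qed

lemma kernel_bar_properties:
  assumes "kernel_profile R"
  shows kernel_bar_nonneg: "0 \<le> r \<Longrightarrow> 0 \<le> kernel_bar R r"
    and kernel_bar_antimono: "\<lbrakk>0 \<le> r; r \<le> t\<rbrakk> \<Longrightarrow> kernel_bar R t \<le> kernel_bar R r"
    and kernel_bar_quarter_pos: "0 < kernel_bar R (1/4)"
proof -
  obtain R\<^sub>0 B \<gamma> where R0: "R\<^sub>0 \<in> borel_measurable borel" "\<And>r. r \<ge> 0 \<Longrightarrow> R\<^sub>0 r = R r"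
    "\<And>r. 0 \<le> R\<^sub>0 r" "\<And>r. R\<^sub>0 r \<le> B" "integrable lborel R\<^sub>0"
    "\<gamma> > 0" "\<And>r. r \<in> {0..1/2} \<Longrightarrow> \<gamma> \<le> R\<^sub>0 r"
    by (rule kernel_profileE[OF assms]) (rule that; assumption)
  have eq: "kernel_bar R r = (LINT s|lborel. indicator {r..} s * R\<^sub>0 s)" if "0 \<le> r" for r
    unfolding kernel_bar_def set_lebesgue_integral_def
    using that R0(2) by (intro Bochner_Integration.integral_cong) (auto simp: indicator_def)
  have int: "integrable lborel (\<lambda>s. indicator {r..} s * R\<^sub>0 s)" for r :: real
    using integrable_mult_indicator[OF _ R0(5), of "{r..}"] by simp
  show "0 \<le> kernel_bar R r" if "0 \<le> r"
    using R0(3) by (simp add: eq[OF that])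
  show "kernel_bar R t \<le> kernel_bar R r" if "0 \<le> r" "r \<le> t"
    unfolding eq[OF that(1)] eq[OF order_trans[OF that]]
    using that(2) R0(3) by (intro integral_mono int) (auto simp: indicator_def)
  have "\<gamma> / 4 = (LINT s|lborel. \<gamma> * indicator {1/4..1/2::real} s)" by simp
  also have "\<dots> \<le> (LINT s|lborel. indicator {1/4..} s * R\<^sub>0 s)"
  proof (rule integral_mono[OF _ int])
    show "integrable lborel (\<lambda>s. \<gamma> * indicator {1/4..1/2::real} s)" by simp
    show "\<gamma> * indicator {1/4..1/2} s \<le> indicator {1/4..} s * R\<^sub>0 s" for s :: real
      using R0(3)[of s] R0(7)[of s] by (auto simp: indicator_def)
  qed
  finally show "0 < kernel_bar R (1/4)" using eq[of "1/4"] \<open>\<gamma> > 0\<close> by simp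
qed

text \<open>
  Monotonicity of \<open>kernel_bar R\<close> on \<open>[0,\<infinity>)\<close> suffices for measurability, since squared norms are
  nonnegative.
\<close>

lemma borel_measurable_scaled_kernel_bar:
  fixes x :: "real^'n"
  assumes "kernel_profile R"
  shows "scaled_kernel \<alpha> (kernel_bar R) \<delta> x \<in> borel_measurable borel"
proof -
  define K where "K r = - kernel_bar R (max 0 r)" for r
  have "mono K"
    using kernel_bar_antimono[OF assms] by (auto simp: K_def mono_def max_def)
  then have K: "K \<in> borel_measurable borel" by (rule borel_measurable_mono)
  have "scaled_kernel \<alpha> (kernel_bar R) \<delta> x = (\<lambda>y. \<alpha> / \<delta> ^ CARD('n) * - K ((norm (x - y))\<^sup>2 / (4 * \<delta>\<^sup>2)))"
    by (auto simp: scaled_kernel_def K_def max_def)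
  then show ?thesis using K by simp
qed

text \<open>
  The profile is bounded below up to the argument \<open>1 / 2\<close>. For points at distance less than \<open>\<delta>\<close> the argument
  is at most \<open>1 / 4\<close>, which leaves the interval from \<open>1 / 4\<close> to \<open>1 / 2\<close> to bound \<open>kernel_bar\<close> below.
\<close>

lemma square_ratio_le_quarter:
  fixes x y :: "'a::metric_space"
  assumes "dist x y < \<delta>"
  shows "(dist x y)\<^sup>2 / (4 * \<delta>\<^sup>2) \<le> 1 / 4"
proof -
  have "0 < \<delta>" using assms zero_le_dist[of x y] by linarith
  have "(dist x y)\<^sup>2 \<le> \<delta>\<^sup>2" using assms by (intro power_mono) auto
  then show ?thesis using \<open>0 < \<delta>\<close> by (simp add: field_simps)
qed

text \<open>
  Near \<open>x\<close> the kernel is at least a positive constant, and the part of the boundary near \<open>x\<close> has positive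
  measure.
\<close>

lemma boundary_integral:
  fixes \<Omega> :: "(real^'n) set"
  assumes \<Omega>: "smooth_boundary \<Omega>" "bounded \<Omega>" and R: "kernel_profile R"
    and "\<alpha> > 0" "\<delta> > 0"
  defines "I \<equiv> (\<lambda>x. LINT y:frontier \<Omega>|surface_measure. scaled_kernel \<alpha> (kernel_bar R) \<delta> x y)"
  shows boundary_integral_nonneg: "0 \<le> I x"
    and boundary_integral_pos: "x \<in> frontier \<Omega> \<Longrightarrow> 0 < I x"
proof -
  let ?K = "scaled_kernel \<alpha> (kernel_bar R) \<delta>"
  define c where "c = \<alpha> / \<delta> ^ CARD('n)"
  have "c > 0" using \<open>\<alpha> > 0\<close> \<open>\<delta> > 0\<close> by (simp add: c_def)
  have K: "?K x y = c * kernel_bar R ((dist x y)\<^sup>2 / (4 * \<delta>\<^sup>2))" for x y :: "real^'n"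
    by (simp add: scaled_kernel_def c_def dist_norm)
  have nonneg: "0 \<le> ?K x y" for x y :: "real^'n"
    unfolding K using \<open>c > 0\<close> kernel_bar_nonneg[OF R] by simp
  have upper: "?K x y \<le> c * kernel_bar R 0" for x y :: "real^'n"
    unfolding K using \<open>c > 0\<close> kernel_bar_antimono[OF R, of 0] by simp
  show "0 \<le> I x"
    using nonneg by (simp add: I_def set_lebesgue_integral_def)
  assume x: "x \<in> frontier \<Omega>"
  have meas: "?K x \<in> borel_measurable surface_measure"
    using borel_measurable_scaled_kernel_bar[OF R]
    by (simp add: measurable_cong_sets[OF sets_surface_measure refl])
  let ?E = "frontier \<Omega> \<inter> ball x \<delta>"
  have sets: "frontier \<Omega> \<in> sets surface_measure" "?E \<in> sets surface_measure"
    by (auto simp: sets_surface_measure)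
  have fin: "emeasure surface_measure (frontier \<Omega>) < top"
    by (rule emeasure_frontier_finite[OF \<Omega>])
  then have finE: "emeasure surface_measure ?E < top"
    using emeasure_mono[of ?E "frontier \<Omega>" surface_measure] sets by (auto intro: le_less_trans)
  have "0 < measure surface_measure ?E"
    using emeasure_frontier_ball_pos[OF \<Omega>(1) x \<open>\<delta> > 0\<close>] finE
    by (simp add: measure_def enn2real_positive_iff)
  then have "0 < c * kernel_bar R (1/4) * measure surface_measure ?E"
    using \<open>c > 0\<close> kernel_bar_quarter_pos[OF R] by simp
  also have "\<dots> = (LINT y|surface_measure. c * kernel_bar R (1/4) * indicator ?E y)"
    using sets by simp
  also have "\<dots> \<le> (LINT y|surface_measure. indicator (frontier \<Omega>) y *\<^sub>R ?K x y)"
  proof (rule integral_mono)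
    show "integrable surface_measure (\<lambda>y. c * kernel_bar R (1/4) * indicator ?E y)"
      using sets(2) finE by (intro integrable_mult_right integrable_real_indicator) auto
    show "integrable surface_measure (\<lambda>y. indicator (frontier \<Omega>) y *\<^sub>R ?K x y)"
      using fin nonneg[of x] upper[of x]
      by (intro integrableI_bounded_set_indicator[where B = "c * kernel_bar R 0"] sets(1) meas) auto
    fix y
    have "c * kernel_bar R (1/4) \<le> ?K x y" if "y \<in> ball x \<delta>"
      unfolding K using \<open>c > 0\<close> that
      by (intro mult_left_mono kernel_bar_antimono[OF R] square_ratio_le_quarter) auto
    then show "c * kernel_bar R (1/4) * indicator ?E y \<le> indicator (frontier \<Omega>) y *\<^sub>R ?K x y"
      using nonneg[of x y] by (auto simp: indicator_def)
  qed
  also have "\<dots> = I x" by (simp add: I_def set_lebesgue_integral_def)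
  finally show "0 < I x" .
qed

text \<open>
  At a minimum of \<open>u\<close> the integrand of the nonlocal diffusion term is nonpositive. If its integral is
  nonnegative, it vanishes almost everywhere. The set of points of \<open>\<Omega>\<close> within distance \<open>\<delta>\<close> of \<open>x\<close> where \<open>u\<close>
  exceeds the minimum is open; it is also negligible, because the kernel does not vanish there; so it is
  empty.
\<close>

lemma eq_min_near:
  fixes \<Omega> :: "(real^'n) set"
  assumes \<Omega>: "open \<Omega>" "bounded \<Omega>" and R: "kernel_profile R" and "\<alpha> > 0" "\<delta> > 0"
    and u: "continuous_on (closure \<Omega>) u" and min: "\<And>y. y \<in> closure \<Omega> \<Longrightarrow> u x \<le> u y"
    and ge: "0 \<le> (LINT y:\<Omega>|lborel. scaled_kernel \<alpha> R \<delta> x y * (u x - u y))"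
    and y: "y \<in> \<Omega>" "dist x y < \<delta>"
  shows "u y = u x"
proof -
  obtain R\<^sub>0 B \<gamma> where R0: "R\<^sub>0 \<in> borel_measurable borel" "\<And>r. r \<ge> 0 \<Longrightarrow> R\<^sub>0 r = R r"
    "\<And>r. 0 \<le> R\<^sub>0 r" "\<And>r. R\<^sub>0 r \<le> B" "integrable lborel R\<^sub>0"
    "\<gamma> > 0" "\<And>r. r \<in> {0..1/2} \<Longrightarrow> \<gamma> \<le> R\<^sub>0 r"
    by (rule kernel_profileE[OF R]) (rule that; assumption)
  define c where "c = \<alpha> / \<delta> ^ CARD('n)"
  have "c > 0" using \<open>\<alpha> > 0\<close> \<open>\<delta> > 0\<close> by (simp add: c_def)
  define k where "k y = c * R\<^sub>0 ((dist x y)\<^sup>2 / (4 * \<delta>\<^sup>2))" for y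
  define h where "h y = indicator \<Omega> y *\<^sub>R (u y - u x)" for y
  have k: "scaled_kernel \<alpha> R \<delta> x y = k y" for y
    using R0(2) by (simp add: scaled_kernel_def k_def c_def dist_norm)
  have k_meas: "k \<in> borel_measurable lborel"
    using R0(1) unfolding k_def by measurable
  have h_nonneg: "0 \<le> h y" for y
    using min[of y] closure_subset[of \<Omega>] by (auto simp: h_def indicator_def)
  have k_bounds: "0 \<le> k y" "k y \<le> c * B" for y
    using R0(3,4) \<open>c > 0\<close> by (auto simp: k_def)
  have u\<Omega>: "continuous_on \<Omega> u" using u closure_subset by (rule continuous_on_subset)
  have h_meas: "h \<in> borel_measurable lborel"
    unfolding h_def using u\<Omega> \<Omega>(1)
    by (simp add: borel_measurable_continuous_on_indicator continuous_on_diff del: real_scaleR_def)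
  have "bounded (u ` closure \<Omega>)"
    using u \<Omega>(2) by (intro compact_imp_bounded compact_continuous_image) auto
  then obtain M where M: "\<And>y. y \<in> closure \<Omega> \<Longrightarrow> \<bar>u y\<bar> \<le> M"
    unfolding bounded_iff by auto
  have h_le: "h y \<le> \<bar>M - u x\<bar>" for y
    using M[of y] closure_subset[of \<Omega>] by (auto simp: h_def indicator_def)
  have "integrable lborel (\<lambda>y. k y * h y)"
  proof (rule integrableI_bounded_set[of \<Omega>])
    show "\<Omega> \<in> sets lborel" using \<Omega>(1) by simp
    show "(\<lambda>y. k y * h y) \<in> borel_measurable lborel" using k_meas h_meas by measurable
    show "emeasure lborel \<Omega> < \<infinity>" using \<Omega>(2) by (rule emeasure_bounded_finite)
    have "\<bar>k y * h y\<bar> \<le> c * B * \<bar>M - u x\<bar>" for y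
      using k_bounds[of y] h_nonneg[of y] h_le[of y] by (simp add: abs_mult mult_mono)
    then show "AE y in lborel. y \<in> \<Omega> \<longrightarrow> norm (k y * h y) \<le> c * B * \<bar>M - u x\<bar>" by simp
    show "AE y in lborel. y \<notin> \<Omega> \<longrightarrow> k y * h y = 0" by (simp add: h_def)
  qed
  moreover have "(LINT y|lborel. k y * h y) = 0"
  proof -
    have "(LINT y:\<Omega>|lborel. scaled_kernel \<alpha> R \<delta> x y * (u x - u y)) = (LINT y|lborel. - (k y * h y))"
      unfolding set_lebesgue_integral_def k
      by (intro Bochner_Integration.integral_cong) (auto simp: h_def indicator_def algebra_simps)
    moreover have "0 \<le> (LINT y|lborel. k y * h y)"
      using k_bounds h_nonneg by simp
    ultimately show ?thesis using ge by simp
  qed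
  ultimately have AE: "AE y in lborel. k y * h y = 0"
    using k_bounds h_nonneg by (subst (asm) integral_nonneg_eq_0_iff_AE) auto
  show ?thesis
  proof (rule ccontr)
    assume "u y \<noteq> u x"
    let ?U = "{z \<in> \<Omega> \<inter> ball x \<delta>. u x < u z}"
    have "?U = ball x \<delta> \<inter> (\<Omega> \<inter> u -` {u x<..})" by auto
    then have "open ?U"
      using continuous_open_preimage[OF u\<Omega> \<Omega>(1), of "{u x<..}"] by (simp add: open_Int)
    have pos: "k z * h z \<noteq> 0" if "z \<in> ?U" for z
    proof -
      have "\<gamma> \<le> R\<^sub>0 ((dist x z)\<^sup>2 / (4 * \<delta>\<^sup>2))"
        using square_ratio_le_quarter[of x z \<delta>] that by (intro R0(7)) auto
      then have "k z > 0" using \<open>\<gamma> > 0\<close> \<open>c > 0\<close> by (simp add: k_def)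
      moreover have "h z > 0" using that by (simp add: h_def)
      ultimately show ?thesis by simp
    qed
    have "AE z in lborel. z \<notin> ?U"
      using AE by eventually_elim (use pos in blast)
    then have "?U \<in> null_sets lborel"
      using \<open>open ?U\<close> by (subst AE_iff_null_sets) auto
    then have "negligible ?U"
      by (simp add: negligible_iff_null_sets null_sets_completionI)
    moreover have "y \<in> ?U" using y min[of y] closure_subset[of \<Omega>] \<open>u y \<noteq> u x\<close> by auto
    ultimately show False using open_not_negligible[OF \<open>open ?U\<close>] by blast
  qed
qed

section \<open>The minimum principle\<close>

theorem lemma3p1:
  fixes \<Omega> :: "(real^'n) set"
    and R :: "real \<Rightarrow> real"
    and \<alpha> \<delta> :: real
    and \<mu> u :: "real^'n \<Rightarrow> real"
  assumes "bounded \<Omega>" and "connected \<Omega>" and "open \<Omega>" and "smooth_boundary \<Omega>"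
    and "kernel_profile R"
    and "\<alpha> > 0"
    and "\<forall>d>0. \<forall>x :: real^'n. (LINT y|lborel. scaled_kernel \<alpha> (kernel_bar R) d x y) = 1"
    and "\<delta> > 0"
    and "\<forall>x\<in>closure \<Omega>. \<mu> x > 0"
    and "continuous_on (closure \<Omega>) u"
    and "\<forall>x\<in>closure \<Omega>. L_op \<alpha> R \<Omega> \<delta> \<mu> u x \<ge> 0"
  shows "\<forall>x\<in>closure \<Omega>. u x \<ge> 0"
proof (rule ccontr)
  assume "\<not> (\<forall>x\<in>closure \<Omega>. u x \<ge> 0)"
  then obtain z where z: "z \<in> closure \<Omega>" "u z < 0" by force
  define interior_part where
    "interior_part x = (LINT y:\<Omega>|lborel. scaled_kernel \<alpha> R \<delta> x y * (u x - u y))" for x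
  define boundary_part where
    "boundary_part x = (LINT y:frontier \<Omega>|surface_measure. scaled_kernel \<alpha> (kernel_bar R) \<delta> x y)" for x
  have L: "0 \<le> interior_part x / \<delta>\<^sup>2 + 2 * u x / \<mu> x * boundary_part x" if "x \<in> closure \<Omega>" for x
    using assms(11) that by (simp add: L_op_def interior_part_def boundary_part_def)
  have boundary_nonneg: "0 \<le> boundary_part x" for x
    unfolding boundary_part_def
    by (rule boundary_integral_nonneg[OF assms(4,1,5,6,8)])
  have "compact (closure \<Omega>)" "closure \<Omega> \<noteq> {}" using assms(1) z(1) by auto
  from continuous_attains_inf[OF this assms(10)] obtain x\<^sub>0
    where x0: "x\<^sub>0 \<in> closure \<Omega>" and min: "\<And>y. y \<in> closure \<Omega> \<Longrightarrow> u x\<^sub>0 \<le> u y"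
    by blast
  have "u x\<^sub>0 < 0" using min[OF z(1)] z(2) by linarith
  \<comment> \<open>being a minimum point is passed on to all points of the closed domain within distance \<open>\<delta>\<close>\<close>
  let ?Z = "{x \<in> closure \<Omega>. u x = u x\<^sub>0}"
  have spread: "u y = u x\<^sub>0" if x: "x \<in> ?Z" and y: "y \<in> closure \<Omega>" "dist x y < \<delta>" for x y
  proof -
    have "2 * u x / \<mu> x \<le> 0"
      using x \<open>u x\<^sub>0 < 0\<close> assms(9) by (intro divide_nonpos_pos) auto
    then have "2 * u x / \<mu> x * boundary_part x \<le> 0"
      using boundary_nonneg by (rule mult_nonpos_nonneg)
    then have "0 \<le> interior_part x / \<delta>\<^sup>2" using L[of x] x by auto
    then have "0 \<le> interior_part x" using assms(8) by (simp add: zero_le_divide_iff)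
    then have inner: "u w = u x\<^sub>0" if "w \<in> \<Omega>" "dist x w < \<delta>" for w
      using eq_min_near[OF assms(3,1,5,6,8,10), of x w] x min that by (simp add: interior_part_def)
    have "y \<in> closure (\<Omega> \<inter> ball x \<delta>)"
      using y open_Int_closure_subset[of "ball x \<delta>" \<Omega>] by (auto simp: Int_commute)
    moreover have "closure (\<Omega> \<inter> ball x \<delta>) \<subseteq> closure \<Omega>" by (intro closure_mono) auto
    then have "continuous_on (closure (\<Omega> \<inter> ball x \<delta>)) u"
      using assms(10) continuous_on_subset by blast
    ultimately show ?thesis
      using continuous_constant_on_closure[of "\<Omega> \<inter> ball x \<delta>" u "u x\<^sub>0" y] inner by auto
  qed
  have "openin (top_of_set (closure \<Omega>)) ?Z"
    unfolding openin_contains_ball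
  proof (intro conjI ballI)
    fix x assume x: "x \<in> ?Z"
    have "ball x \<delta> \<inter> closure \<Omega> \<subseteq> ?Z"
      using spread[OF x] by (intro subsetI CollectI conjI) simp_all
    then show "\<exists>e>0. ball x e \<inter> closure \<Omega> \<subseteq> ?Z" using assms(8) by blast
  qed blast
  moreover have "closedin (top_of_set (closure \<Omega>)) ?Z"
    by (rule continuous_closedin_preimage_constant[OF assms(10)])
  moreover have "connected (closure \<Omega>)" using assms(2) by (rule connected_imp_connected_closure)
  ultimately have Z: "?Z = closure \<Omega>"
    using x0 unfolding connected_clopen by blast
  have const: "u y = u x\<^sub>0" if "y \<in> closure \<Omega>" for y
    using that Z by blast
  \<comment> \<open>for constant \<open>u\<close> the diffusion term is zero, and the boundary term decides the sign\<close>
  have "\<Omega> \<noteq> {}" "\<Omega> \<noteq> UNIV" using z(1) assms(1) not_bounded_UNIV by auto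
  then obtain p where p: "p \<in> frontier \<Omega>" using frontier_not_empty by blast
  then have pc: "p \<in> closure \<Omega>" by (simp add: frontier_def)
  have "indicator \<Omega> y *\<^sub>R (scaled_kernel \<alpha> R \<delta> p y * (u p - u y)) = 0" for y
    using const[OF pc] const[of y] closure_subset[of \<Omega>] by (auto simp: indicator_def)
  then have "interior_part p = 0"
    unfolding interior_part_def set_lebesgue_integral_def by (simp only: integral_zero)
  then have "0 \<le> 2 * u p / \<mu> p * boundary_part p" using L[OF pc] by simp
  moreover have "0 < boundary_part p"
    unfolding boundary_part_def
    by (rule boundary_integral_pos[OF assms(4,1,5,6,8) p])
  moreover have "u p < 0" using const[OF pc] \<open>u x\<^sub>0 < 0\<close> by simp
  then have "2 * u p / \<mu> p < 0"
    using assms(9) pc by (intro divide_neg_pos) auto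
  ultimately show False using mult_neg_pos[of "2 * u p / \<mu> p" "boundary_part p"] by linarith
qed

end
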